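(* Let $f:[0,1]\to\mathbb{R}$ be a càdlàg function with graph $G_f^{[0,1]}\subset\mathbb{R}^2$ (with vertical segments joining the discontinuities included, as defined in the context). Suppose there exist a constant $A>0$ and sequences $a_i\in\mathbb{R}^2$, $R_i\in(0,1)$, $n_i\in\mathbb{N}$ ($i\in\mathbb{N}$, $n_i\geq 1$) with $n_i\to\infty$ such that for all $i\in\mathbb{N}$ $$N_{n_i\times n_i}^{R_i\times R_i}\bigl(a_i,G_f^{[0,1]}\bigr)\geq A\,n_i^2 .$$ Then $$\dim_{\mathrm{A}} G_f^{[0,1]}=2 .$$
   Context: Graph: for a càdlàg function $f$ (right continuous with left limits) and an interval $I$, $G_f^{I}=\{(t,y): y=f(t),\ t\in I\}\cup J$, where $J$ is the union of the vertical segments joining $(t,f(t-))$ to $(t,f(t))$ over the discontinuities $t\in I$ of $f$ ($f(t-)$ is the left limit). If $f$ is continuous, $J=\emptyset$. Windows: for $R_1,R_2>0$, positive integers $n_1,n_2$ and $a\in\mathbb{R}^2$, let $W_{n_1\times n_2}^{R_1\times R_2}(a)$ be the collection of rectangles $D_{i,j}+a$, where $D_{i,j}=\left[\frac{i}{n_1}R_1,\frac{i+1}{n_1}R_1\right]\times\left[\frac{j}{n_2}R_2,\frac{j+1}{n_2}R_2\right]$, $i\in\{0,\dots,n_1-1\}$, $j\in\{0,\dots,n_2-1\}$. Let $N_{n_1\times n_2}^{R_1\times R_2}(a,G)$ be the number of rectangles in $W_{n_1\times n_2}^{R_1\times R_2}(a)$ that intersect the set $G$. Assouad dimension: a non-empty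 compact set $F\subset\mathbb{R}^2$ is $s$-homogeneous if there is $C>0$ such that for all $R>0$, $r\in(0,R]$ and $x\in F$, $N(B(x,R)\cap F,r)\leq C(R/r)^s$, where $B(x,R)$ is the closed ball of centre $x$ and radius $R$ and $N(E,r)$ is the number of squares of the $r\times r$ grid that intersect $E$. Then $\dim_{\mathrm{A}}F=\inf\{s\geq 0: F\text{ is } s\text{-homogeneous}\}$. *)

theory Defs
  imports "HOL-Analysis.Analysis"
begin

text \<open>
  A function on a set \<open>D\<close> of reals (in practice an interval) is represented by a total function of
  which only the values on \<open>D\<close> matter; all limits are relative to \<open>D\<close>. At the left endpoint of
  \<open>D\<close> the filter of the left limit is trivial, so no condition is imposed there.
\<close>

definition cadlag_on :: "real set \<Rightarrow> (real \<Rightarrow> real) \<Rightarrow> bool" where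
  "cadlag_on D f \<longleftrightarrow>
     (\<forall>t\<in>D. continuous (at t within (D \<inter> {t..})) f \<and>
            (\<exists>l. (f \<longlongrightarrow> l) (at t within (D \<inter> {..<t}))))"

definition left_lim :: "real set \<Rightarrow> (real \<Rightarrow> real) \<Rightarrow> real \<Rightarrow> real" where
  "left_lim D f t = Lim (at t within (D \<inter> {..<t})) f"

text \<open>
  The graph over \<open>I \<subseteq> D\<close> of a cadlag function \<open>f\<close> with domain \<open>D\<close>. A discontinuity of such an \<open>f\<close>
  is never the left endpoint of \<open>D\<close>, so the left limit used here always exists and is unique.
\<close>

definition cadlag_graph :: "real set \<Rightarrow> (real \<Rightarrow> real) \<Rightarrow> real set \<Rightarrow> (real \<times> real) set" where
  "cadlag_graph D f I =
     {(t, y). t \<in> I \<and> y = f t} \<union>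
     (\<Union>t\<in>{t\<in>I. \<not> continuous (at t within D) f}. closed_segment (t, left_lim D f t) (t, f t))"

definition window_cell :: "real \<Rightarrow> real \<Rightarrow> nat \<Rightarrow> nat \<Rightarrow> nat \<Rightarrow> nat \<Rightarrow> (real \<times> real) set" where
  "window_cell R1 R2 n1 n2 i j =
     {real i / real n1 * R1 .. (real i + 1) / real n1 * R1} \<times>
     {real j / real n2 * R2 .. (real j + 1) / real n2 * R2}"

definition window :: "real \<Rightarrow> real \<Rightarrow> nat \<Rightarrow> nat \<Rightarrow> real \<times> real \<Rightarrow> (real \<times> real) set set" where
  "window R1 R2 n1 n2 a =
     {(\<lambda>p. p + a) ` window_cell R1 R2 n1 n2 i j | i j. i < n1 \<and> j < n2}"

definition window_count ::
    "real \<Rightarrow> real \<Rightarrow> nat \<Rightarrow> nat \<Rightarrow> real \<times> real \<Rightarrow> (real \<times> real) set \<Rightarrow> nat" where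
  "window_count R1 R2 n1 n2 a G = card {Q \<in> window R1 R2 n1 n2 a. Q \<inter> G \<noteq> {}}"

definition grid_squares :: "real \<Rightarrow> (real \<times> real) set set" where
  "grid_squares r =
     {{of_int i * r .. (of_int i + 1) * r} \<times> {of_int j * r .. (of_int j + 1) * r} | i j :: int. True}"

definition grid_count :: "(real \<times> real) set \<Rightarrow> real \<Rightarrow> nat" where
  "grid_count E r = card {Q \<in> grid_squares r. Q \<inter> E \<noteq> {}}"

text \<open>
  The product metric on \<open>real \<times> real\<close> is the Euclidean one. The two notions below are meant for
  non-empty compact \<open>F\<close>. For bounded \<open>E\<close> and \<open>r > 0\<close> only finitely many grid squares meet \<open>E\<close>, so
  the convention that infinite sets have cardinality 0 plays no role; and every \<open>F\<close> in the plane is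
  2-homogeneous, so the infimum is over a non-empty set.
\<close>

definition homogeneous :: "real \<Rightarrow> (real \<times> real) set \<Rightarrow> bool" where
  "homogeneous s F \<longleftrightarrow>
     (\<exists>C>0. \<forall>R>0. \<forall>r\<in>{0<..R}. \<forall>x\<in>F.
        real (grid_count (cball x R \<inter> F) r) \<le> C * (R / r) powr s)"

definition assouad_dim :: "(real \<times> real) set \<Rightarrow> real" where
  "assouad_dim F = Inf {s. 0 \<le> s \<and> homogeneous s F}"

end

theory Submission imports Defs begin

text \<open>
  The upper bound holds for every planar set. For the lower bound, take a point of the graph in the
  \<open>i\<close>-th window: the ball of radius \<open>2 R\<^sub>i\<close> around it contains the window, and at scale
  \<open>R\<^sub>i / n\<^sub>i\<close> each grid square accounts for at most nine window cells. An \<open>s\<close>-homogeneous graph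
  therefore satisfies \<open>A n\<^sub>i\<^sup>2 \<le> 9 C (2 n\<^sub>i)\<^sup>s\<close> for all \<open>i\<close>, which forces \<open>s \<ge> 2\<close> as \<open>n\<^sub>i \<rightarrow> \<infinity>\<close>.
\<close>

text \<open>Explicit indexing of the members of \<open>grid_squares r\<close>, so that counting
  squares becomes counting pairs of integers.\<close>

definition grid_square :: "real \<Rightarrow> int \<Rightarrow> int \<Rightarrow> (real \<times> real) set" where
  "grid_square r k l = {of_int k * r .. (of_int k + 1) * r} \<times> {of_int l * r .. (of_int l + 1) * r}"

lemma grid_square_eq_iff:
  assumes "r > 0"
  shows "grid_square r k l = grid_square r k' l' \<longleftrightarrow> k = k' \<and> l = l'"
  using assms by (auto simp: grid_square_def times_eq_iff Icc_eq_Icc mult_le_cancel_right)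

text \<open>The integers in question form \<open>{\<lceil>x\<rceil>..\<lfloor>y\<rfloor>}\<close>.
  The cardinality bound asks for \<open>x \<le> y\<close> because otherwise \<open>y - x + 1\<close>
  may be negative.\<close>

lemma card_int_interval_le:
  fixes x y :: real
  shows "finite {k::int. x \<le> of_int k \<and> of_int k \<le> y}"
    and "x \<le> y \<Longrightarrow> real (card {k::int. x \<le> of_int k \<and> of_int k \<le> y}) \<le> y - x + 1"
proof -
  have eq: "{k::int. x \<le> of_int k \<and> of_int k \<le> y} = {\<lceil>x\<rceil>..\<lfloor>y\<rfloor>}"
    by (auto simp: ceiling_le_iff le_floor_iff)
  show "finite {k::int. x \<le> of_int k \<and> of_int k \<le> y}"
    by (simp add: eq)
  assume "x \<le> y"
  then show "real (card {k::int. x \<le> of_int k \<and> of_int k \<le> y}) \<le> y - x + 1"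
    unfolding eq card_atLeastAtMost_int by linarith
qed

lemma grid_count_eq_card_indices:
  assumes "r > 0"
  shows "grid_count E r = card {(k, l). grid_square r k l \<inter> E \<noteq> {}}"
proof -
  have "{Q \<in> grid_squares r. Q \<inter> E \<noteq> {}}
      = (\<lambda>(k, l). grid_square r k l) ` {(k, l). grid_square r k l \<inter> E \<noteq> {}}"
    unfolding grid_squares_def grid_square_def[symmetric] by auto
  moreover have "inj_on (\<lambda>(k, l). grid_square r k l) {(k, l). grid_square r k l \<inter> E \<noteq> {}}"
    using grid_square_eq_iff[OF assms] by (auto simp: inj_on_def)
  ultimately show ?thesis
    by (simp add: grid_count_def card_image)
qed

text \<open>A point of the square with first index \<open>k\<close> has first coordinate between
  \<open>k * r\<close> and \<open>(k + 1) * r\<close>, and also within \<open>R\<close> of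
  \<open>fst x\<close>; solving for \<open>k\<close> gives the bounds, the right end of the square
  being responsible for the \<open>- 1\<close>.\<close>

lemma grid_indices_cball_subset:
  assumes "r > 0" and "E \<subseteq> cball x R"
  shows "{(k, l). grid_square r k l \<inter> E \<noteq> {}}
    \<subseteq> {k. (fst x - R) / r - 1 \<le> of_int k \<and> of_int k \<le> (fst x + R) / r} \<times>
       {l. (snd x - R) / r - 1 \<le> of_int l \<and> of_int l \<le> (snd x + R) / r}"
proof clarsimp
  fix k l assume "grid_square r k l \<inter> E \<noteq> {}"
  then obtain p where p: "p \<in> grid_square r k l" "p \<in> cball x R"
    using assms(2) by blast
  have "\<bar>fst x - fst p\<bar> \<le> R" "\<bar>snd x - snd p\<bar> \<le> R"
    using p(2) dist_fst_le[of x p] dist_snd_le[of x p] by (auto simp: dist_real_def)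
  then show "(fst x - R) / r - 1 \<le> of_int k \<and> of_int k \<le> (fst x + R) / r \<and>
      (snd x - R) / r - 1 \<le> of_int l \<and> of_int l \<le> (snd x + R) / r"
    using p(1) assms(1) by (auto simp: grid_square_def mem_Times_iff field_simps)
qed

lemma finite_grid_indices:
  assumes "r > 0" and "bounded E"
  shows "finite {(k, l). grid_square r k l \<inter> E \<noteq> {}}"
proof -
  obtain x R where "E \<subseteq> cball x R"
    using assms(2) unfolding bounded_def by (auto simp: subset_eq)
  from grid_indices_cball_subset[OF assms(1) this] show ?thesis
    by (rule finite_subset) (intro finite_cartesian_product
      card_int_interval_le(1)[of "_ - 1"] card_int_interval_le(1))
qed

text \<open>Boundedness of \<open>E\<close> matters: \<open>card\<close> is 0 on infinite sets,
  which would break monotonicity.\<close>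

lemma grid_count_mono:
  assumes "r > 0" and "bounded E" and "D \<subseteq> E"
  shows "grid_count D r \<le> grid_count E r"
  unfolding grid_count_eq_card_indices[OF assms(1)]
  by (rule card_mono[OF finite_grid_indices[OF assms(1,2)]]) (use assms(3) in auto)

lemma homogeneous_2: "homogeneous 2 F"
  unfolding homogeneous_def
\<comment> \<open>Each coordinate admits at most \<open>2 * (R / r) + 2\<close> indices, which is at
  most \<open>4 * (R / r)\<close> since \<open>r \<le> R\<close>; two coordinates give 16.\<close>
proof (intro exI[of _ 16] conjI allI impI ballI)
  fix R r :: real and x
  assume "0 < R" and "r \<in> {0<..R}"
  then have r: "0 < r" "r \<le> R" by auto
  define I where "I c = {k::int. (c - R) / r - 1 \<le> of_int k \<and> of_int k \<le> (c + R) / r}" for c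
  have fin: "finite (I c)" for c
    unfolding I_def by (rule card_int_interval_le(1))
  have card_I: "real (card (I c)) \<le> 4 * (R / r)" for c
  proof -
    have "real (card (I c)) \<le> (c + R) / r - ((c - R) / r - 1) + 1"
      unfolding I_def by (rule card_int_interval_le(2)) (use r in \<open>simp add: field_simps\<close>)
    also have "\<dots> = 2 * (R / r) + 2" by (simp add: add_divide_distrib diff_divide_distrib)
    also have "\<dots> \<le> 4 * (R / r)" using r by (simp add: field_simps)
    finally show ?thesis .
  qed
  have "grid_count (cball x R \<inter> F) r \<le> card (I (fst x) \<times> I (snd x))"
    unfolding grid_count_eq_card_indices[OF r(1)]
    by (rule card_mono) (use fin grid_indices_cball_subset[OF r(1), of "cball x R \<inter> F" x R]
        in \<open>auto simp: I_def\<close>)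
  then have "real (grid_count (cball x R \<inter> F) r) \<le> real (card (I (fst x))) * real (card (I (snd x)))"
    by (metis card_cartesian_product of_nat_le_iff of_nat_mult)
  also have "\<dots> \<le> (4 * (R / r)) * (4 * (R / r))"
    using r by (intro mult_mono card_I) auto
  also have "\<dots> = 16 * (R / r) powr 2"
    using r by (simp add: power2_eq_square)
  finally show "real (grid_count (cball x R \<inter> F) r) \<le> 16 * (R / r) powr 2" .
qed simp

text \<open>The window is a translate by \<open>a\<close> and need not be aligned with the grid.
  Each cell meeting \<open>F\<close> is charged to a grid square containing a common point; such a
  square overlaps at most three columns and three rows of cells.\<close>

lemma window_count_le_grid_count:
  fixes a :: "real \<times> real"
  assumes "R > 0" and "n \<ge> 1"
  defines "W \<equiv> {fst a..fst a + R} \<times> {snd a..snd a + R}"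
  shows "window_count R R n n a F \<le> 9 * grid_count (W \<inter> F) (R / n)"
proof -
  define r where "r = R / n"
  have r: "r > 0" and nr: "real n * r = R" using assms by (auto simp: r_def)
  define cell where "cell = (\<lambda>(i, j). (\<lambda>p. p + a) ` window_cell R R n n i j)"
  have mem_cell: "p \<in> cell (i, j) \<longleftrightarrow>
      real i * r \<le> fst p - fst a \<and> fst p - fst a \<le> (real i + 1) * r \<and>
      real j * r \<le> snd p - snd a \<and> snd p - snd a \<le> (real j + 1) * r" for p i j
  proof -
    have "p \<in> cell (i, j) \<longleftrightarrow> p - a \<in> window_cell R R n n i j"
      unfolding cell_def by (auto intro: image_eqI[of _ _ "p - a"])
    then show ?thesis
      by (auto simp: window_cell_def mem_Times_iff r_def)
  qed
  define S where "S = {(k, l). grid_square r k l \<inter> (W \<inter> F) \<noteq> {}}"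
  define I where "I = {ij \<in> {..<n} \<times> {..<n}. cell ij \<inter> F \<noteq> {}}"
  \<comment> \<open>\<open>J c k\<close> holds the \<open>i\<close> for which
    \<open>[c + i * r, c + (i + 1) * r]\<close> meets \<open>[k * r, (k + 1) * r]\<close>, touching
    included. These lie in an interval of length 2, hence at most three of them.\<close>
  define J where "J c k = {i::nat. of_int k - 1 - c / r \<le> real i \<and> real i \<le> of_int k + 1 - c / r}"
    for c :: real and k :: int
  have J: "finite (J c k) \<and> card (J c k) \<le> 3" for c k
  proof -
    let ?K = "{m::int. of_int k - 1 - c / r \<le> of_int m \<and> of_int m \<le> of_int k + 1 - c / r}"
    have sub: "int ` J c k \<subseteq> ?K" by (auto simp: J_def)
    have "real (card ?K) \<le> (of_int k + 1 - c / r) - (of_int k - 1 - c / r) + 1"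
      by (rule card_int_interval_le(2)) simp
    then have "card ?K \<le> 3" by simp
    moreover have finK: "finite ?K" by (rule card_int_interval_le(1))
    moreover have "card (int ` J c k) = card (J c k)" by (simp add: card_image)
    moreover have "finite (J c k)"
      using finite_subset[OF sub finK] by (simp add: finite_image_iff)
    ultimately show ?thesis
      using card_mono[OF finK sub] by linarith
  qed
  have "bounded (W \<inter> F)"
    unfolding W_def by (intro bounded_Int disjI1 bounded_Times bounded_closed_interval)
  then have finS: "finite S"
    unfolding S_def by (rule finite_grid_indices[OF r])
  have "I \<subseteq> (\<Union>(k, l)\<in>S. J (fst a) k \<times> J (snd a) l)"
  proof
    fix ij assume "ij \<in> I"
    then obtain i j p where ij: "ij = (i, j)" "i < n" "j < n" and p: "p \<in> cell (i, j)" "p \<in> F"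
      by (auto simp: I_def)
    \<comment> \<open>The last index \<open>n - 1\<close> has right end \<open>n * r = R\<close>, so
      every cell stays inside \<open>W\<close>.\<close>
    have in_window: "0 \<le> real m * r \<and> (real m + 1) * r \<le> R" if "m < n" for m
      unfolding nr[symmetric] using that r by (auto intro!: mult_right_mono)
    have pW: "p \<in> W"
      using p(1) in_window[OF ij(2)] in_window[OF ij(3)]
      unfolding W_def mem_cell by (auto simp: mem_Times_iff)
    \<comment> \<open>A point on a grid line lies in several squares; the floor selects one.\<close>
    define k l where "k = \<lfloor>fst p / r\<rfloor>" and "l = \<lfloor>snd p / r\<rfloor>"
    have k: "of_int k * r \<le> fst p" "fst p \<le> (of_int k + 1) * r"
     and l: "of_int l * r \<le> snd p" "snd p \<le> (of_int l + 1) * r"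
      using floor_divide_lower[OF r] floor_divide_upper[OF r]
      by (auto simp: k_def l_def intro: less_imp_le)
    have "p \<in> grid_square r k l"
      using k l by (auto simp: grid_square_def mem_Times_iff)
    then have "(k, l) \<in> S" using pW p(2) by (auto simp: S_def)
    moreover have "i \<in> J (fst a) k" "j \<in> J (snd a) l"
      using p(1) k l r unfolding mem_cell J_def by (auto simp: field_simps)
    ultimately show "ij \<in> (\<Union>(k, l)\<in>S. J (fst a) k \<times> J (snd a) l)"
      using ij(1) by blast
  qed
  then have "card I \<le> card (\<Union>(k, l)\<in>S. J (fst a) k \<times> J (snd a) l)"
    using finS J by (intro card_mono finite_UN_I) auto
  also have "\<dots> \<le> (\<Sum>(k, l)\<in>S. card (J (fst a) k \<times> J (snd a) l))"
    using card_UN_le[OF finS, of "\<lambda>(k, l). J (fst a) k \<times> J (snd a) l"]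
    by (simp add: case_prod_beta)
  also have "\<dots> \<le> (\<Sum>kl\<in>S. 9)"
  proof (rule sum_mono)
    fix kl
    have "card (J (fst a) (fst kl)) * card (J (snd a) (snd kl)) \<le> 3 * 3"
      using J by (intro mult_le_mono) auto
    then show "(case kl of (k, l) \<Rightarrow> card (J (fst a) k \<times> J (snd a) l)) \<le> 9"
      by (simp add: case_prod_beta card_cartesian_product)
  qed
  also have "\<dots> = 9 * grid_count (W \<inter> F) r"
    unfolding S_def grid_count_eq_card_indices[OF r] by simp
  finally have "card I \<le> 9 * grid_count (W \<inter> F) r" .
  \<comment> \<open>The cells counted are the image of \<open>I\<close> under \<open>cell\<close>,
    and an image is no larger than its source.\<close>
  moreover have "window_count R R n n a F \<le> card I"
  proof -
    have "{Q \<in> window R R n n a. Q \<inter> F \<noteq> {}} = cell ` I"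
      by (auto simp: window_def cell_def I_def)
    then show ?thesis
      unfolding window_count_def by (simp add: card_image_le I_def)
  qed
  ultimately show ?thesis by (simp add: r_def)
qed

text \<open>Homogeneity speaks only of balls centred in \<open>F\<close>, so the ball is centred at
  an arbitrary point of \<open>F\<close> in the window and its radius is doubled to cover the
  window.\<close>

lemma homogeneous_window_count_le:
  assumes "homogeneous s F"
  obtains C where "\<And>R n a. R > 0 \<Longrightarrow> n \<ge> 1 \<Longrightarrow> real (window_count R R n n a F) \<le> C * real n powr s"
proof -
  obtain C where C: "C > 0" and
    hom: "\<And>R r x. R > 0 \<Longrightarrow> r \<in> {0<..R} \<Longrightarrow> x \<in> F \<Longrightarrow>
        real (grid_count (cball x R \<inter> F) r) \<le> C * (R / r) powr s"
    using assms unfolding homogeneous_def by blast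
  show ?thesis
  \<comment> \<open>The 9 comes from comparing cells with grid squares, the \<open>2 powr s\<close>
    from the radius \<open>2 * R\<close>, whose ratio to the scale \<open>R / n\<close> is
    \<open>2 * n\<close>.\<close>
  proof (rule that[of "9 * C * 2 powr s"])
    fix R :: real and n :: nat and a :: "real \<times> real"
    assume R: "R > 0" and n: "n \<ge> 1"
    define W where "W = {fst a..fst a + R} \<times> {snd a..snd a + R}"
    have r: "R / n > 0" "R / n \<le> 2 * R" using R n by (auto simp: field_simps)
    have le: "real (window_count R R n n a F) \<le> 9 * real (grid_count (W \<inter> F) (R / n))"
      using window_count_le_grid_count[OF R n, of a F] unfolding W_def by linarith
    have "real (grid_count (W \<inter> F) (R / n)) \<le> C * (2 * real n) powr s"
    \<comment> \<open>If the window misses \<open>F\<close> there is no centre to use, but the count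
      is then 0.\<close>
    proof (cases "W \<inter> F = {}")
      case True
      then show ?thesis using C by (simp add: grid_count_def)
    next
      case False
      then obtain x where x: "x \<in> W" "x \<in> F" by blast
      have "W \<subseteq> cball x (2 * R)"
      proof
        fix y assume "y \<in> W"
        then have "\<bar>fst x - fst y\<bar> \<le> R" "\<bar>snd x - snd y\<bar> \<le> R"
          using x by (auto simp: W_def mem_Times_iff)
        then show "y \<in> cball x (2 * R)"
          using sqrt_sum_squares_le_sum_abs[of "fst x - fst y" "snd x - snd y"]
          by (simp add: dist_prod_def dist_real_def)
      qed
      then have "grid_count (W \<inter> F) (R / n) \<le> grid_count (cball x (2 * R) \<inter> F) (R / n)"
        by (intro grid_count_mono r) (auto intro: bounded_subset[OF bounded_cball])
      also have "real \<dots> \<le> C * (2 * R / (R / n)) powr s"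
        using R r x by (intro hom) auto
      finally show ?thesis using R by simp
    qed
    with le show "real (window_count R R n n a F) \<le> 9 * C * 2 powr s * real n powr s"
      by (simp add: powr_mult)
  qed
qed

theorem theorem2p2:
  fixes f :: "real \<Rightarrow> real" and A :: real
    and a :: "nat \<Rightarrow> real \<times> real" and R :: "nat \<Rightarrow> real" and n :: "nat \<Rightarrow> nat"
  assumes "cadlag_on {0..1} f"
    and "A > 0"
    and "\<And>i. R i \<in> {0<..<1}"
    and "\<And>i. n i \<ge> 1"
    and "filterlim n at_top sequentially"
    and "\<And>i. real (window_count (R i) (R i) (n i) (n i) (a i) (cadlag_graph {0..1} f {0..1}))
               \<ge> A * (real (n i))\<^sup>2"
  shows "assouad_dim (cadlag_graph {0..1} f {0..1}) = 2"
  unfolding assouad_dim_def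
\<comment> \<open>The infimum is attained: 2 is an admissible exponent and no smaller one
  is.\<close>
proof (rule cInf_eq_minimum)
  let ?G = "cadlag_graph {0..1} f {0..1}"
  show "2 \<in> {s. 0 \<le> s \<and> homogeneous s ?G}"
    by (simp add: homogeneous_2)
  fix s assume "s \<in> {s. 0 \<le> s \<and> homogeneous s ?G}"
  then have "homogeneous s ?G" by simp
  then obtain C where
    C: "\<And>R n a. R > 0 \<Longrightarrow> n \<ge> 1 \<Longrightarrow> real (window_count R R n n a ?G) \<le> C * real n powr s"
    using homogeneous_window_count_le by blast
  show "2 \<le> s"
  proof (rule ccontr)
    assume "\<not> 2 \<le> s"
    then have s: "s - 2 < 0" by simp
    \<comment> \<open>Dividing by the square of \<open>n i\<close> leaves the negative exponent
      \<open>s - 2\<close>, so the right side tends to 0 while \<open>A\<close> stays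
      positive.\<close>
    have lower: "A \<le> C * real (n i) powr (s - 2)" for i
    proof -
      have pos: "real (n i) > 0" using assms(4)[of i] by simp
      have "A * (real (n i))\<^sup>2 \<le> C * real (n i) powr s"
        using assms(6)[of i] C[of "R i" "n i" "a i"] assms(3)[of i] assms(4)[of i] by simp
      also have "\<dots> = C * real (n i) powr (s - 2) * (real (n i))\<^sup>2"
        using pos by (simp add: powr_diff)
      finally show ?thesis using pos by simp
    qed
    have "filterlim (\<lambda>i. real (n i)) at_top sequentially"
      using assms(5) by (rule filterlim_compose[OF filterlim_real_sequentially])
    then have "(\<lambda>i. C * real (n i) powr (s - 2)) \<longlonglongrightarrow> C * 0"
      by (intro tendsto_intros tendsto_neg_powr[OF s])
    then have "A \<le> C * 0"
      by (rule LIMSEQ_le_const) (use lower in auto)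
    then show False using assms(2) by simp
  qed
qed

end
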